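(* Let $E$ be a separable complex Hilbert space, $\sigma>0$ and $\theta\in[0,2\pi)$. Let $\mathcal{M}$ be a nonzero closed subspace of $H^2_E(\mathbb{T})\oplus E$, and assume that $\mathcal{M}\subseteq H^2_E(\mathbb{T})\oplus\{0\}$. Then $B^E_{\sigma,e^{i\theta}}(\mathcal{M})\subseteq\mathcal{M}$ if and only if \[ \mathcal{M}=\Phi H^2_{E_1}(\mathbb{T})\oplus\{0\} \] for some nonzero Hilbert space $E_1$ and some inner function $\Phi\in H^\infty_{\mathcal{B}(E_1,E)}(\mathbb{T})$.
   Context: $\mathbb{D}=\{z\in\mathbb{C}:|z|<1\}$ and $\mathbb{T}=\partial\mathbb{D}$. For a complex Hilbert space $E$, $H^2_E(\mathbb{T})$ is the $E$-valued Hardy space, i.e. the closed subspace of $L^2_E(\mathbb{T})$ of functions whose Fourier coefficients of negative index vanish (equivalently, square-summable $E$-valued power series on $\mathbb{D}$), and $S_E$ is the shift $S_Ef=zf$ on it. Elements of $E$ are identified with constant functions; $i_E:E\to H^2_E(\mathbb{T})$ is the inclusion $(i_Ex)(z)=x$. The Brownian shift on $H^2_E(\mathbb{T})\oplus E$ of covariance $\sigma>0$ and angle $\theta\in[0,2\pi)$ is the bounded operator \[ B^E_{\sigma,e^{i\theta}}=\begin{bmatrix}S_E&\sigma i_E\\ 0&e^{i\theta}I_E\end{bmatrix},\qquad B^E_{\sigma,e^{i\theta}}\begin{bmatrix}f\\ x\end{bmatrix}=\begin{bmatrix}zf+\sigma x\\ e^{i\theta}x\end{bmatrix}. \] For Hilbert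 spaces $E_*,E$, $H^\infty_{\mathcal{B}(E_*,E)}(\mathbb{T})$ is the Banach space of bounded analytic functions on $\mathbb{D}$ with values in $\mathcal{B}(E_*,E)$ (bounded operators from $E_*$ to $E$). Each such $\Phi$ induces the multiplication operator $M_\Phi:H^2_{E_*}(\mathbb{T})\to H^2_E(\mathbb{T})$, $M_\Phi f=\Phi f$; $\Phi$ is called inner if $M_\Phi$ is an isometry (equivalently, $\Phi(z)$ is an isometry for almost every $z\in\mathbb{T}$). $\Phi H^2_{E_*}(\mathbb{T})$ denotes the range of $M_\Phi$. *)

theory Defs
  imports "HOL-Analysis.Analysis"
begin

section \<open>Complex Hilbert spaces\<close>

text \<open>
  A complex inner product space is presented as a real inner product space (which supplies norm and
  topology) carrying a compatible complex structure: the real inner product is the real part of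
  the complex one.  The complex inner product is linear in its first argument.
\<close>

class complex_inner = real_inner +
  fixes scaleC :: "complex \<Rightarrow> 'a \<Rightarrow> 'a" (infixr "*\<^sub>C" 75)
    and cinner :: "'a \<Rightarrow> 'a \<Rightarrow> complex"
  assumes scaleC_add_right: "a *\<^sub>C (x + y) = a *\<^sub>C x + a *\<^sub>C y"
    and scaleC_add_left: "(a + b) *\<^sub>C x = a *\<^sub>C x + b *\<^sub>C x"
    and scaleC_scaleC [simp]: "a *\<^sub>C b *\<^sub>C x = (a * b) *\<^sub>C x"
    and scaleR_scaleC: "r *\<^sub>R x = complex_of_real r *\<^sub>C x"
    and cinner_commute: "cinner x y = cnj (cinner y x)"
    and cinner_add_left: "cinner (x + y) z = cinner x z + cinner y z"
    and cinner_scaleC_left [simp]: "cinner (a *\<^sub>C x) y = a * cinner x y"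
    and inner_eq_Re_cinner: "inner x y = Re (cinner x y)"

class chilbert_space = complex_inner + banach

lemma scaleC_one [simp]: "1 *\<^sub>C x = (x :: 'a :: complex_inner)"
  using scaleR_scaleC[of 1 x] by simp

global_interpretation complex_vector: vector_space "scaleC :: complex \<Rightarrow> 'a \<Rightarrow> 'a :: complex_inner"
  by unfold_locales (simp_all add: scaleC_add_right scaleC_add_left)

lemma cinner_self: "cinner x x = complex_of_real ((norm x)\<^sup>2)" for x :: "'a :: complex_inner"
proof -
  have "Re (cinner x x) = (norm x)\<^sup>2"
    by (simp add: power2_norm_eq_inner inner_eq_Re_cinner)
  moreover have "Im (cinner x x) = 0"
    using arg_cong[OF cinner_commute[of x x], of Im] by (simp only: cnj.sel)
  ultimately show ?thesis by (simp add: complex_eq_iff)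
qed

lemma norm_scaleC [simp]: "norm (a *\<^sub>C x) = cmod a * norm x" for x :: "'a :: complex_inner"
proof -
  have "cinner (a *\<^sub>C x) (a *\<^sub>C x) = a * cnj (a * cinner x x)"
    by (subst (1) cinner_scaleC_left, subst (1) cinner_commute, subst (1) cinner_scaleC_left)
      (rule refl)
  also have "\<dots> = (a * cnj a) * complex_of_real ((norm x)\<^sup>2)"
    by (simp add: cinner_self)
  also have "\<dots> = complex_of_real ((cmod a * norm x)\<^sup>2)"
    by (simp add: power_mult_distrib flip: complex_norm_square)
  finally have "(norm (a *\<^sub>C x))\<^sup>2 = (cmod a * norm x)\<^sup>2"
    unfolding cinner_self of_real_eq_iff .
  then show ?thesis by (simp add: power2_eq_iff_nonneg)
qed

lemma norm_cinner_le: "cmod (cinner x y) \<le> norm x * norm y" for x y :: "'a :: complex_inner"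
proof (cases "cinner x y = 0")
  case False
  define a where "a = cnj (sgn (cinner x y))"
  have a: "cmod a = 1" using False by (simp add: a_def norm_sgn)
  have "a * cinner x y = complex_of_real (cmod (cinner x y))"
  proof -
    have "a * cinner x y = (cinner x y * cnj (cinner x y)) / complex_of_real (cmod (cinner x y))"
      by (simp only: a_def sgn_eq complex_cnj_divide complex_cnj_complex_of_real) simp
    also have "\<dots> = complex_of_real ((cmod (cinner x y))\<^sup>2 / cmod (cinner x y))"
      by (simp only: complex_norm_square[symmetric] of_real_divide)
    finally show ?thesis by (simp add: power2_eq_square)
  qed
  then have "cmod (cinner x y) = inner (a *\<^sub>C x) y"
    by (simp add: inner_eq_Re_cinner)
  also have "\<dots> \<le> norm (a *\<^sub>C x) * norm y" by (rule norm_cauchy_schwarz)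
  finally show ?thesis by (simp add: a)
qed simp

instantiation complex :: complex_inner
begin

definition scaleC_complex_def: "a *\<^sub>C x = a * (x :: complex)"
definition cinner_complex_def: "cinner x y = x * cnj (y :: complex)"

instance
  by standard (simp_all add: scaleC_complex_def cinner_complex_def inner_complex_def
      scaleR_conv_of_real algebra_simps)

end

instance complex :: chilbert_space ..

instantiation prod :: (complex_inner, complex_inner) complex_inner
begin

definition scaleC_prod_def: "a *\<^sub>C p = (a *\<^sub>C fst p, a *\<^sub>C snd p)"
definition cinner_prod_def: "cinner p q = cinner (fst p) (fst q) + cinner (snd p) (snd q)"

instance
proof
  fix x y :: "'a \<times> 'b"
  show "cinner x y = cnj (cinner y x)"
    unfolding cinner_prod_def complex_cnj_add
    using cinner_commute[of "fst x" "fst y"] cinner_commute[of "snd x" "snd y"] by simp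
qed (simp_all add: scaleC_prod_def cinner_prod_def scaleC_add_right scaleC_add_left scaleR_scaleC
    scaleR_prod_def cinner_add_left inner_prod_def inner_eq_Re_cinner algebra_simps)

end

instance prod :: (chilbert_space, chilbert_space) chilbert_space ..

definition closed_csubspace :: "'a :: complex_inner set \<Rightarrow> bool" where
  "closed_csubspace S \<longleftrightarrow> complex_vector.subspace S \<and> closed S"

section \<open>The vector-valued Hardy space\<close>

text \<open>
  An element of the Hardy space is represented by its sequence of power series coefficients
  (equivalently, its nonnegative Fourier coefficients); \<open>hardy_eval\<close> below is the
  associated function on the unit disc.
\<close>

typedef (overloaded) 'a hardy = "{f :: nat \<Rightarrow> 'a :: complex_inner. summable (\<lambda>n. (norm (f n))\<^sup>2)}"
  morphisms coeff_hardy Abs_hardy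
  by (rule exI[of _ "\<lambda>_. 0"]) simp

setup_lifting type_definition_hardy

lemma sum_sq_bound: "(a + b)\<^sup>2 \<le> 2 * a\<^sup>2 + 2 * b\<^sup>2" for a b :: real
  using sum_squares_bound[of a b] by (simp add: power2_sum)

lemma summable_coeff_sq: "summable (\<lambda>n. (norm (coeff_hardy f n))\<^sup>2)"
  using coeff_hardy[of f] by simp

lemma summable_sq_add:
  fixes f g :: "nat \<Rightarrow> 'a :: real_normed_vector"
  assumes "summable (\<lambda>n. (norm (f n))\<^sup>2)" "summable (\<lambda>n. (norm (g n))\<^sup>2)"
  shows "summable (\<lambda>n. (norm (f n + g n))\<^sup>2)"
proof (rule summable_comparison_test')
  show "summable (\<lambda>n. 2 * (norm (f n))\<^sup>2 + 2 * (norm (g n))\<^sup>2)"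
    by (intro summable_add summable_mult assms)
  fix n
  have "(norm (f n + g n))\<^sup>2 \<le> (norm (f n) + norm (g n))\<^sup>2"
    by (intro power_mono norm_triangle_ineq) simp
  also have "\<dots> \<le> 2 * (norm (f n))\<^sup>2 + 2 * (norm (g n))\<^sup>2" by (rule sum_sq_bound)
  finally show "norm ((norm (f n + g n))\<^sup>2) \<le> 2 * (norm (f n))\<^sup>2 + 2 * (norm (g n))\<^sup>2" by simp
qed

lemma summable_norm_mult:
  fixes f g :: "nat \<Rightarrow> 'a :: real_normed_vector"
  assumes "summable (\<lambda>n. (norm (f n))\<^sup>2)" "summable (\<lambda>n. (norm (g n))\<^sup>2)"
  shows "summable (\<lambda>n. norm (f n) * norm (g n))"
proof (rule summable_comparison_test')
  show "summable (\<lambda>n. (norm (f n))\<^sup>2 + (norm (g n))\<^sup>2)" by (intro summable_add assms)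
  show "norm (norm (f n) * norm (g n)) \<le> (norm (f n))\<^sup>2 + (norm (g n))\<^sup>2" for n
  proof -
    have "0 \<le> norm (f n) * norm (g n)" by simp
    moreover have "2 * (norm (f n) * norm (g n)) \<le> (norm (f n))\<^sup>2 + (norm (g n))\<^sup>2"
      using sum_squares_bound[of "norm (f n)" "norm (g n)"] by (simp only: mult.assoc)
    ultimately have "norm (f n) * norm (g n) \<le> (norm (f n))\<^sup>2 + (norm (g n))\<^sup>2" by linarith
    then show ?thesis by simp
  qed
qed

lemma summable_cinner_coeff:
  "summable (\<lambda>n. cinner (coeff_hardy f n) (coeff_hardy g n))"
  by (rule summable_comparison_test'[OF summable_norm_mult[OF summable_coeff_sq[of f] summable_coeff_sq[of g]]])
    (rule norm_cinner_le)

lemma summable_inner_coeff: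
  "summable (\<lambda>n. inner (coeff_hardy f n) (coeff_hardy g n))"
  unfolding inner_eq_Re_cinner by (rule summable_Re[OF summable_cinner_coeff])

instantiation hardy :: (complex_inner) real_vector
begin

lift_definition zero_hardy :: "'a hardy" is "\<lambda>_. 0" by simp
lift_definition plus_hardy :: "'a hardy \<Rightarrow> 'a hardy \<Rightarrow> 'a hardy" is "\<lambda>f g n. f n + g n"
  by (rule summable_sq_add)
lift_definition uminus_hardy :: "'a hardy \<Rightarrow> 'a hardy" is "\<lambda>f n. - f n" by simp
definition minus_hardy :: "'a hardy \<Rightarrow> 'a hardy \<Rightarrow> 'a hardy" where "minus_hardy f g = f + - g"
lift_definition scaleR_hardy :: "real \<Rightarrow> 'a hardy \<Rightarrow> 'a hardy" is "\<lambda>r f n. r *\<^sub>R f n"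
  by (simp add: power_mult_distrib summable_mult)

instance
proof
  fix f g h :: "'a hardy" and r s :: real
  show "f + g + h = f + (g + h)" by transfer (simp add: add.assoc)
  show "f + g = g + f" by transfer (simp add: add.commute)
  show "0 + f = f" by transfer simp
  show "- f + f = 0" by transfer simp
  show "f - g = f + - g" by (rule minus_hardy_def)
  show "r *\<^sub>R (f + g) = r *\<^sub>R f + r *\<^sub>R g" by transfer (simp add: scaleR_add_right)
  show "(r + s) *\<^sub>R f = r *\<^sub>R f + s *\<^sub>R f" by transfer (simp add: scaleR_add_left)
  show "r *\<^sub>R s *\<^sub>R f = (r * s) *\<^sub>R f" by transfer simp
  show "1 *\<^sub>R f = f" by transfer simp
qed

end

instantiation hardy :: (complex_inner) complex_inner
begin

lift_definition scaleC_hardy :: "complex \<Rightarrow> 'a hardy \<Rightarrow> 'a hardy" is "\<lambda>a f n. a *\<^sub>C f n"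
  by (simp add: power_mult_distrib summable_mult)
definition cinner_hardy :: "'a hardy \<Rightarrow> 'a hardy \<Rightarrow> complex" where
  "cinner_hardy f g = (\<Sum>n. cinner (coeff_hardy f n) (coeff_hardy g n))"
definition inner_hardy :: "'a hardy \<Rightarrow> 'a hardy \<Rightarrow> real" where
  "inner_hardy f g = Re (cinner f g)"
definition norm_hardy :: "'a hardy \<Rightarrow> real" where
  "norm_hardy f = sqrt (inner f f)"
definition sgn_hardy :: "'a hardy \<Rightarrow> 'a hardy" where "sgn_hardy f = f /\<^sub>R norm f"
definition dist_hardy :: "'a hardy \<Rightarrow> 'a hardy \<Rightarrow> real" where "dist_hardy f g = norm (f - g)"
definition uniformity_hardy :: "('a hardy \<times> 'a hardy) filter" where
  "uniformity_hardy = (INF e\<in>{0<..}. principal {(x, y). dist x y < e})"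
definition open_hardy :: "'a hardy set \<Rightarrow> bool" where
  "open_hardy U \<longleftrightarrow> (\<forall>x\<in>U. eventually (\<lambda>(x', y). x' = x \<longrightarrow> y \<in> U) uniformity)"

instance
proof
  fix f g h :: "'a hardy" and r s :: real and a b :: complex
  show addr: "a *\<^sub>C (f + g) = a *\<^sub>C f + a *\<^sub>C g" for a and f g :: "'a hardy"
    by transfer (simp add: scaleC_add_right)
  show addl: "(a + b) *\<^sub>C f = a *\<^sub>C f + b *\<^sub>C f" for a b and f :: "'a hardy"
    by transfer (simp add: scaleC_add_left)
  show sc: "a *\<^sub>C b *\<^sub>C f = (a * b) *\<^sub>C f" for a b and f :: "'a hardy"
    by transfer simp
  show scR: "r *\<^sub>R f = complex_of_real r *\<^sub>C f" for r and f :: "'a hardy"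
    by transfer (simp add: scaleR_scaleC)
  show "sgn f = f /\<^sub>R norm f" by (rule sgn_hardy_def)
  show "dist f g = norm (f - g)" by (rule dist_hardy_def)
  show "norm f = sqrt (inner f f)" by (rule norm_hardy_def)
  show "inner f g = Re (cinner f g)" by (rule inner_hardy_def)
  show comm: "cinner f g = cnj (cinner g f)" for f g :: "'a hardy"
  proof -
    have "cnj (cinner (coeff_hardy g n) (coeff_hardy f n)) = cinner (coeff_hardy f n) (coeff_hardy g n)" for n
      by (rule cinner_commute[symmetric])
    moreover have "(\<lambda>n. cnj (cinner (coeff_hardy g n) (coeff_hardy f n))) sums cnj (cinner g f)"
      unfolding cinner_hardy_def sums_cnj by (rule summable_sums[OF summable_cinner_coeff])
    ultimately have "(\<lambda>n. cinner (coeff_hardy f n) (coeff_hardy g n)) sums cnj (cinner g f)"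
      by (simp only:)
    then show ?thesis unfolding cinner_hardy_def[of f g] by (rule sums_unique[symmetric])
  qed
  show cadd: "cinner (f + g) h = cinner f h + cinner g h" for f g h :: "'a hardy"
    using suminf_add[OF summable_cinner_coeff[of f h] summable_cinner_coeff[of g h]]
    by (simp only: cinner_hardy_def plus_hardy.rep_eq cinner_add_left)
  show csc: "cinner (a *\<^sub>C f) g = a * cinner f g" for a and f g :: "'a hardy"
    using suminf_mult[OF summable_cinner_coeff[of f g], of a]
    by (simp only: cinner_hardy_def scaleC_hardy.rep_eq cinner_scaleC_left)
  show "inner f g = inner g f" unfolding inner_hardy_def by (subst comm) (rule cnj.sel(1))
  show "inner (f + g) h = inner f h + inner g h" by (simp add: inner_hardy_def cadd)
  show "inner (r *\<^sub>R f) g = r * inner f g" by (simp add: inner_hardy_def scR csc)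
  have self: "inner f f = (\<Sum>n. (norm (coeff_hardy f n))\<^sup>2)"
    unfolding inner_hardy_def cinner_hardy_def
    by (subst Re_suminf[OF summable_cinner_coeff]) (simp add: cinner_self)
  show "0 \<le> inner f f" unfolding self by (intro suminf_nonneg summable_coeff_sq) simp
  show "(inner f f = 0) = (f = 0)"
    unfolding self by (subst suminf_eq_zero_iff[OF summable_coeff_sq])
      (auto simp: coeff_hardy_inject[symmetric] zero_hardy.rep_eq fun_eq_iff)
  show "uniformity = (INF e\<in>{0<..}. principal {(x :: 'a hardy, y). dist x y < e})"
    by (rule uniformity_hardy_def)
  show "open U \<longleftrightarrow> (\<forall>x\<in>U. eventually (\<lambda>(x', y). x' = x \<longrightarrow> y \<in> U) uniformity)"
    for U :: "'a hardy set" by (rule open_hardy_def)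
qed

end

lemma norm_hardy_sq: "(norm f)\<^sup>2 = (\<Sum>n. (norm (coeff_hardy f n))\<^sup>2)"
proof -
  have "(norm f)\<^sup>2 = Re (cinner f f)" by (simp add: cinner_self)
  also have "\<dots> = (\<Sum>n. Re (cinner (coeff_hardy f n) (coeff_hardy f n)))"
    unfolding cinner_hardy_def by (rule Re_suminf[OF summable_cinner_coeff])
  finally show ?thesis by (simp add: cinner_self)
qed

lemma coeff_hardy_diff: "coeff_hardy (f - g) n = coeff_hardy f n - coeff_hardy g n"
  unfolding minus_hardy_def plus_hardy.rep_eq uminus_hardy.rep_eq by simp

lemma sum_coeff_le_norm_hardy:
  "finite A \<Longrightarrow> (\<Sum>n\<in>A. (norm (coeff_hardy f n))\<^sup>2) \<le> (norm f)\<^sup>2"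
  unfolding norm_hardy_sq by (intro sum_le_suminf summable_coeff_sq) auto

lemma norm_coeff_le: "norm (coeff_hardy f n) \<le> norm f"
  using sum_coeff_le_norm_hardy[of "{n}" f] by (simp add: power2_le_iff_abs_le)

instance hardy :: (chilbert_space) chilbert_space
proof
  fix X :: "nat \<Rightarrow> 'a hardy"
  assume X: "Cauchy X"
  have "Cauchy (\<lambda>m. coeff_hardy (X m) n)" for n
  proof (rule metric_CauchyI)
    fix e :: real assume "0 < e"
    then obtain M where M: "\<And>m k. m \<ge> M \<Longrightarrow> k \<ge> M \<Longrightarrow> dist (X m) (X k) < e"
      using metric_CauchyD[OF X] by blast
    have "dist (coeff_hardy (X m) n) (coeff_hardy (X k) n) < e" if "m \<ge> M" "k \<ge> M" for m k
      using norm_coeff_le[of "X m - X k" n] M[OF that] by (simp add: dist_norm coeff_hardy_diff)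
    then show "\<exists>M. \<forall>m\<ge>M. \<forall>k\<ge>M. dist (coeff_hardy (X m) n) (coeff_hardy (X k) n) < e" by blast
  qed
  then obtain a where a: "\<And>n. (\<lambda>m. coeff_hardy (X m) n) \<longlonglongrightarrow> a n"
    unfolding Cauchy_convergent_iff convergent_def by metis
  have tail: "\<exists>M. \<forall>m\<ge>M. \<forall>K. (\<Sum>n<K. (norm (coeff_hardy (X m) n - a n))\<^sup>2) \<le> e\<^sup>2"
    if "0 < e" for e :: real
  proof -
    obtain M where M: "\<And>m k. m \<ge> M \<Longrightarrow> k \<ge> M \<Longrightarrow> dist (X m) (X k) < e"
      using metric_CauchyD[OF X \<open>0 < e\<close>] by blast
    have "(\<Sum>n<K. (norm (coeff_hardy (X m) n - a n))\<^sup>2) \<le> e\<^sup>2" if m: "m \<ge> M" for m K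
    proof (rule LIMSEQ_le_const2)
      show "(\<lambda>k. \<Sum>n<K. (norm (coeff_hardy (X m) n - coeff_hardy (X k) n))\<^sup>2)
          \<longlonglongrightarrow> (\<Sum>n<K. (norm (coeff_hardy (X m) n - a n))\<^sup>2)"
        by (intro tendsto_intros a)
      have "(\<Sum>n<K. (norm (coeff_hardy (X m) n - coeff_hardy (X k) n))\<^sup>2) \<le> e\<^sup>2" if "k \<ge> M" for k
      proof -
        have "(\<Sum>n<K. (norm (coeff_hardy (X m) n - coeff_hardy (X k) n))\<^sup>2) \<le> (norm (X m - X k))\<^sup>2"
          using sum_coeff_le_norm_hardy[of "{..<K}" "X m - X k"] by (simp add: coeff_hardy_diff)
        also have "\<dots> \<le> e\<^sup>2"
          using M[OF m that] by (intro power_mono) (simp_all add: dist_norm)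
        finally show ?thesis .
      qed
      then show "\<exists>N. \<forall>k\<ge>N. (\<Sum>n<K. (norm (coeff_hardy (X m) n - coeff_hardy (X k) n))\<^sup>2) \<le> e\<^sup>2"
        by blast
    qed
    then show ?thesis by blast
  qed
  have summ: "summable (\<lambda>n. (norm (coeff_hardy (X m) n - a n))\<^sup>2)"
    if "\<forall>K. (\<Sum>n<K. (norm (coeff_hardy (X m) n - a n))\<^sup>2) \<le> e\<^sup>2" for m e
    using that by (intro summableI_nonneg_bounded[where x = "e\<^sup>2"]) auto
  have "summable (\<lambda>n. (norm (a n))\<^sup>2)"
  proof -
    obtain m where m: "\<forall>K. (\<Sum>n<K. (norm (coeff_hardy (X m) n - a n))\<^sup>2) \<le> 1\<^sup>2"
      using tail[of 1] by auto
    have "summable (\<lambda>n. (norm (a n - coeff_hardy (X m) n))\<^sup>2)"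
      using summ[OF m] by (simp add: norm_minus_commute)
    from summable_sq_add[OF this summable_coeff_sq[of "X m"]] show ?thesis by simp
  qed
  then obtain f where f: "coeff_hardy f = a" by (metis Abs_hardy_inverse mem_Collect_eq)
  have "X \<longlonglongrightarrow> f"
  proof (rule metric_LIMSEQ_I)
    fix e :: real assume "0 < e"
    then obtain M where M: "\<forall>m\<ge>M. \<forall>K. (\<Sum>n<K. (norm (coeff_hardy (X m) n - a n))\<^sup>2) \<le> (e / 2)\<^sup>2"
      using tail[of "e / 2"] by auto
    have "dist (X m) f < e" if "m \<ge> M" for m
    proof -
      have *: "\<forall>K. (\<Sum>n<K. (norm (coeff_hardy (X m) n - a n))\<^sup>2) \<le> (e / 2)\<^sup>2" using M that by blast
      have "(norm (X m - f))\<^sup>2 \<le> (e / 2)\<^sup>2"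
        unfolding norm_hardy_sq coeff_hardy_diff f using * by (intro suminf_le_const summ[OF *]) auto
      then have "norm (X m - f) \<le> e / 2" using \<open>0 < e\<close> by (simp add: power2_le_iff_abs_le)
      then show ?thesis using \<open>0 < e\<close> by (simp add: dist_norm)
    qed
    then show "\<exists>M. \<forall>m\<ge>M. dist (X m) f < e" by blast
  qed
  then show "convergent X" by (rule convergentI)
qed

definition hardy_eval :: "'a :: chilbert_space hardy \<Rightarrow> complex \<Rightarrow> 'a" where
  "hardy_eval f z = (\<Sum>n. z ^ n *\<^sub>C coeff_hardy f n)"

text \<open>
  For a closed subspace \<open>F\<close> of a Hilbert space, itself regarded as a Hilbert space,
  \<open>hardy_on F\<close> is the \<open>F\<close>-valued Hardy space.
\<close>

definition hardy_on :: "'a :: complex_inner set \<Rightarrow> 'a hardy set" where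
  "hardy_on F = {f. \<forall>n. coeff_hardy f n \<in> F}"

lift_definition hardy_const :: "'a :: complex_inner \<Rightarrow> 'a hardy" is "\<lambda>x n. if n = 0 then x else 0"
  by (rule summable_finite[of "{0}"]) auto

lift_definition hardy_shift :: "'a :: complex_inner hardy \<Rightarrow> 'a hardy"
  is "\<lambda>f n. case n of 0 \<Rightarrow> 0 | Suc k \<Rightarrow> f k"
  by (subst summable_Suc_iff[symmetric]) simp

lemma summable_hardy_eval:
  fixes f :: "'a :: chilbert_space hardy"
  assumes "cmod z < 1"
  shows "summable (\<lambda>n. z ^ n *\<^sub>C coeff_hardy f n)"
proof (rule summable_comparison_test')
  show "summable (\<lambda>n. norm f * cmod z ^ n)"
    using assms by (intro summable_mult summable_geometric) simp
  show "norm (z ^ n *\<^sub>C coeff_hardy f n) \<le> norm f * cmod z ^ n" for n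
    using mult_right_mono[OF norm_coeff_le[of f n], of "cmod z ^ n"]
    by (simp add: norm_power mult.commute)
qed

lemma hardy_eval_const: "hardy_eval (hardy_const x) z = x"
proof -
  have "(\<lambda>n. z ^ n *\<^sub>C coeff_hardy (hardy_const x) n) sums
      (\<Sum>n\<in>{0}. z ^ n *\<^sub>C coeff_hardy (hardy_const x) n)"
    by (rule sums_finite) (auto simp: hardy_const.rep_eq)
  then show ?thesis by (simp add: hardy_eval_def sums_iff hardy_const.rep_eq)
qed

lemma bounded_linear_scaleC: "bounded_linear (\<lambda>x :: 'a :: complex_inner. a *\<^sub>C x)"
  by (rule bounded_linear_intro[where K = "cmod a"])
    (simp_all add: scaleC_add_right scaleR_scaleC mult.commute)

lemma hardy_eval_shift:
  fixes f :: "'a :: chilbert_space hardy"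
  assumes "cmod z < 1"
  shows "hardy_eval (hardy_shift f) z = z *\<^sub>C hardy_eval f z"
proof -
  have "(\<lambda>n. z *\<^sub>C z ^ n *\<^sub>C coeff_hardy f n) sums (z *\<^sub>C hardy_eval f z)"
    unfolding hardy_eval_def
    by (rule bounded_linear.sums[OF bounded_linear_scaleC summable_sums[OF summable_hardy_eval[OF assms]]])
  then have "(\<lambda>n. z ^ n *\<^sub>C coeff_hardy (hardy_shift f) n) sums (z *\<^sub>C hardy_eval f z)"
    using sums_Suc_iff[of "\<lambda>n. z ^ n *\<^sub>C coeff_hardy (hardy_shift f) n" "z *\<^sub>C hardy_eval f z"]
    by (simp add: hardy_shift.rep_eq)
  then show ?thesis by (simp add: hardy_eval_def[of "hardy_shift f"] sums_iff)
qed

section \<open>The Brownian shift\<close>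

definition brownian_shift ::
  "real \<Rightarrow> real \<Rightarrow> 'a :: chilbert_space hardy \<times> 'a \<Rightarrow> 'a hardy \<times> 'a" where
  "brownian_shift \<sigma> \<theta> = (\<lambda>(f, x). (hardy_shift f + \<sigma> *\<^sub>R hardy_const x, cis \<theta> *\<^sub>C x))"

section \<open>Operator-valued inner functions\<close>

text \<open>
  Operators on a closed subspace \<open>F\<close> are represented by functions on the ambient type;
  their values off \<open>F\<close> play no role.
\<close>

definition bounded_clinear_on :: "'b :: complex_inner set \<Rightarrow> ('b \<Rightarrow> 'a :: complex_inner) \<Rightarrow> bool" where
  "bounded_clinear_on F A \<longleftrightarrow>
    (\<forall>x\<in>F. \<forall>y\<in>F. A (x + y) = A x + A y) \<and>
    (\<forall>c. \<forall>x\<in>F. A (c *\<^sub>C x) = c *\<^sub>C A x) \<and>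
    (\<exists>K. \<forall>x\<in>F. norm (A x) \<le> K * norm x)"

text \<open>
  Analyticity is expansion in a power series on the disc whose coefficients are bounded operators,
  convergent in operator norm.
\<close>

definition analytic_op_on_disc ::
  "'b :: complex_inner set \<Rightarrow> (complex \<Rightarrow> 'b \<Rightarrow> 'a :: complex_inner) \<Rightarrow> bool" where
  "analytic_op_on_disc F \<Phi> \<longleftrightarrow>
    (\<exists>T. (\<forall>n. bounded_clinear_on F (T n)) \<and>
      (\<forall>z\<in>ball 0 1. \<forall>\<epsilon>>0. \<exists>N. \<forall>n\<ge>N. \<forall>x\<in>F.
        norm (\<Phi> z x - (\<Sum>k<n. z ^ k *\<^sub>C T k x)) \<le> \<epsilon> * norm x))"

definition Hinfty :: "'b :: complex_inner set \<Rightarrow> (complex \<Rightarrow> 'b \<Rightarrow> 'a :: complex_inner) set" where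
  "Hinfty F = {\<Phi>. (\<forall>z\<in>ball 0 1. bounded_clinear_on F (\<Phi> z)) \<and> analytic_op_on_disc F \<Phi> \<and>
    (\<exists>C. \<forall>z\<in>ball 0 1. \<forall>x\<in>F. norm (\<Phi> z x) \<le> C * norm x)}"

text \<open>
  For \<open>\<Phi> \<in> Hinfty F\<close> and \<open>f \<in> hardy_on F\<close> the pointwise product is again (the disc function
  of) a unique element of the Hardy space, so the description below is proper there.
\<close>

definition mult_op ::
  "(complex \<Rightarrow> 'b :: chilbert_space \<Rightarrow> 'a :: chilbert_space) \<Rightarrow> 'b hardy \<Rightarrow> 'a hardy" where
  "mult_op \<Phi> f = (THE g. \<forall>z\<in>ball 0 1. hardy_eval g z = \<Phi> z (hardy_eval f z))"

text \<open>
  The multiplication operator is linear, so being an isometry means preserving the norm.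

  An inner function is isometric at almost every boundary point, so its (nonzero) coefficient space
  embeds isometrically into \<open>'a\<close>, hence, as constant functions, into \<open>'a hardy\<close>.
  Existential statements about ``some Hilbert space'' carrying an \<open>'a\<close>-valued inner function
  may therefore range over the closed subspaces of the single type \<open>'a hardy\<close>: transport along a
  unitary changes neither innerness nor the range of the multiplication operator.
\<close>

definition inner_function ::
  "'b :: chilbert_space set \<Rightarrow> (complex \<Rightarrow> 'b \<Rightarrow> 'a :: chilbert_space) \<Rightarrow> bool" where
  "inner_function F \<Phi> \<longleftrightarrow> \<Phi> \<in> Hinfty F \<and> (\<forall>f\<in>hardy_on F. norm (mult_op \<Phi> f) = norm f)"

end

theory Submission
  imports Defs
begin

text \<open>
  On vectors \<open>(f, 0)\<close> the Brownian shift is just the unilateral shift \<open>S\<close>, so a subspace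
  \<open>N \<times> {0}\<close> is invariant exactly when \<open>S N \<subseteq> N\<close>, and the theorem is the Beurling-Lax theorem.

  Given an invariant closed \<open>N\<close>, the proof is Halmos's wandering subspace argument.  Let
  \<open>W\<close> be the orthogonal complement of \<open>S N\<close> in \<open>N\<close>.  Since \<open>S\<close> is an isometry, the
  spaces \<open>S\<^sup>n W\<close> are pairwise orthogonal, so every square-summable sequence \<open>w\<close> in \<open>W\<close>
  yields a convergent series \<open>\<Sum>n. S\<^sup>n w\<^sub>n\<close> in \<open>N\<close> of norm \<open>norm w\<close>
  (\<open>wandering_synthesis\<close>).  Conversely, splitting \<open>h = w\<^sub>0 + S h\<^sub>1\<close>, then
  \<open>h\<^sub>1 = w\<^sub>1 + S h\<^sub>2\<close>, and so on, expands every \<open>h \<in> N\<close> in this way, because the remainder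
  \<open>S\<^sup>n h\<^sub>n\<close> has the value \<open>z\<^sup>n h\<^sub>n(z)\<close> at \<open>z\<close> and the \<open>h\<^sub>n\<close> are bounded in norm
  (\<open>wandering_analysis\<close>).

  The point that makes the inner function explicit is that \<open>W\<close> is itself a space of functions
  on the disc: take \<open>E\<^sub>1 = W\<close> and let \<open>\<Phi>(z)\<close> be evaluation at \<open>z\<close>.  Then
  \<open>(\<Phi> w)(z) = \<Sum>n. z\<^sup>n w\<^sub>n(z)\<close> is the value at \<open>z\<close> of \<open>\<Sum>n. S\<^sup>n w\<^sub>n\<close>, so
  multiplication by \<open>\<Phi>\<close> is isometric with range \<open>N\<close>.  That \<open>\<Phi>\<close> is bounded on the whole
  disc does not follow from boundedness of evaluations, whose norms grow towards the circle;
  it follows by testing the isometry on Szego kernels (\<open>norm_mult_symbol_le\<close>).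

  For the other implication, multiplication by \<open>\<Phi>\<close> commutes with \<open>S\<close>.
\<close>

section \<open>Geometry of Hilbert spaces\<close>

text \<open>
  The projection theorem: a minimizing sequence for the distance to \<open>S\<close> is Cauchy by the
  parallelogram law, and the residual at its limit is orthogonal to \<open>S\<close>.
\<close>

lemma orthogonal_decomposition_exists:
  fixes S :: "'a :: {real_inner, complete_space} set"
  assumes S: "subspace S" and "closed S"
  shows "\<exists>p\<in>S. \<forall>y\<in>S. inner (x - p) y = 0"
proof -
  define d where "d = (INF y\<in>S. (norm (x - y))\<^sup>2)"
  have bdd: "bdd_below ((\<lambda>y. (norm (x - y))\<^sup>2) ` S)"
    by (rule bdd_belowI[of _ 0]) auto
  have ne: "S \<noteq> {}" using subspace_0[OF S] by auto
  have d_le: "d \<le> (norm (x - y))\<^sup>2" if "y \<in> S" for y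
    unfolding d_def by (rule cINF_lower[OF bdd that])
  have "\<exists>y\<in>S. (norm (x - y))\<^sup>2 < d + 1 / Suc n" for n
  proof -
    have "(INF y\<in>S. (norm (x - y))\<^sup>2) < d + 1 / Suc n" by (simp add: d_def)
    then show ?thesis using cINF_less_iff[OF ne bdd] by blast
  qed
  then obtain q where q: "\<And>n. q n \<in> S" "\<And>n. (norm (x - q n))\<^sup>2 < d + 1 / Suc n"
    by metis
  have close: "(norm (q m - q n))\<^sup>2 \<le> 2 / Suc m + 2 / Suc n" for m n
  proof -
    have mid: "(1/2) *\<^sub>R (q m + q n) \<in> S"
      by (intro subspace_scale subspace_add S q)
    have "(norm (q m - q n))\<^sup>2 =
        2 * (norm (x - q m))\<^sup>2 + 2 * (norm (x - q n))\<^sup>2 - 4 * (norm (x - (1/2) *\<^sub>R (q m + q n)))\<^sup>2"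
      by (simp add: power2_norm_eq_inner inner_simps inner_commute field_simps)
    also have "\<dots> \<le> 2 * (d + 1 / Suc m) + 2 * (d + 1 / Suc n) - 4 * d"
      using q(2)[of m] q(2)[of n] d_le[OF mid] by (intro diff_mono add_mono mult_left_mono) auto
    finally show ?thesis by simp
  qed
  have "Cauchy q"
  proof (rule metric_CauchyI)
    fix e :: real assume "0 < e"
    then obtain N where N: "4 / real (Suc N) < e\<^sup>2"
      using reals_Archimedean[of "e\<^sup>2 / 4"] by (auto simp: field_simps)
    have "dist (q m) (q n) < e" if "m \<ge> N" "n \<ge> N" for m n
    proof -
      have "(norm (q m - q n))\<^sup>2 \<le> 2 / Suc m + 2 / Suc n" by (rule close)
      also have "\<dots> \<le> 2 / Suc N + 2 / Suc N"
        using that by (intro add_mono divide_left_mono) auto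
      also have "\<dots> < e\<^sup>2" using N by simp
      finally show ?thesis using \<open>0 < e\<close> by (simp add: dist_norm power2_less_imp_less)
    qed
    then show "\<exists>N. \<forall>m\<ge>N. \<forall>n\<ge>N. dist (q m) (q n) < e" by blast
  qed
  then obtain p where p: "q \<longlonglongrightarrow> p" using Cauchy_convergent convergent_def by blast
  have pS: "p \<in> S" using closed_sequentially[OF \<open>closed S\<close> _ p] q(1) by blast
  have min: "(norm (x - p))\<^sup>2 \<le> d"
  proof (rule LIMSEQ_le)
    show "(\<lambda>n. (norm (x - q n))\<^sup>2) \<longlonglongrightarrow> (norm (x - p))\<^sup>2" by (intro tendsto_intros p)
    show "(\<lambda>n. d + 1 / real (Suc n)) \<longlonglongrightarrow> d"
      using tendsto_add[OF tendsto_const[of d] LIMSEQ_Suc[OF lim_1_over_n]] by simp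
    show "\<exists>N. \<forall>n\<ge>N. (norm (x - q n))\<^sup>2 \<le> d + 1 / real (Suc n)"
      using q(2) less_imp_le by blast
  qed
  have "inner (x - p) y = 0" if y: "y \<in> S" for y
  proof (cases "y = 0")
    case False
    \<comment> \<open>The minimizer of the quadratic \<open>t \<mapsto> (norm (x - p - t *\<^sub>R y))\<^sup>2\<close>.\<close>
    define t where "t = inner (x - p) y / (norm y)\<^sup>2"
    have "(norm (x - p))\<^sup>2 \<le> (norm (x - (p + t *\<^sub>R y)))\<^sup>2"
      using order_trans[OF min d_le] pS y S by (blast intro: subspace_add subspace_scale)
    also have "\<dots> = (norm (x - p))\<^sup>2 - 2 * t * inner (x - p) y + t\<^sup>2 * (norm y)\<^sup>2"
      by (simp only: power2_norm_eq_inner) (simp add: inner_simps inner_commute algebra_simps power2_eq_square)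
    also have "\<dots> = (norm (x - p))\<^sup>2 - (inner (x - p) y)\<^sup>2 / (norm y)\<^sup>2"
      using False by (simp add: t_def power2_eq_square)
    finally show ?thesis using False by (simp add: divide_le_0_iff)
  qed simp
  with pS show ?thesis by blast
qed

lemma orthogonal_series:
  fixes f :: "nat \<Rightarrow> 'a :: {real_inner, banach}"
  assumes orth: "\<And>m n. m \<noteq> n \<Longrightarrow> inner (f m) (f n) = 0"
    and sq: "summable (\<lambda>n. (norm (f n))\<^sup>2)"
  shows "summable f" and "(norm (suminf f))\<^sup>2 = (\<Sum>n. (norm (f n))\<^sup>2)"
proof -
  have pyth: "(norm (sum f A))\<^sup>2 = (\<Sum>n\<in>A. (norm (f n))\<^sup>2)" if "finite A" for A
    using that orth by (intro norm_sum_Pythagorean) (auto simp: pairwise_def orthogonal_def)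
  show f: "summable f"
    unfolding summable_Cauchy
  proof (intro allI impI)
    fix e :: real assume "0 < e"
    then obtain N where N: "\<And>m n. m \<ge> N \<Longrightarrow> norm (\<Sum>n\<in>{m..<n}. (norm (f n))\<^sup>2) < e\<^sup>2"
      using sq unfolding summable_Cauchy by (metis zero_less_power)
    have "norm (sum f {m..<n}) < e" if "m \<ge> N" for m n
    proof -
      have "(norm (sum f {m..<n}))\<^sup>2 < e\<^sup>2"
        using N[OF that, of n] by (simp add: pyth sum_nonneg)
      then show ?thesis using \<open>0 < e\<close> by (simp add: power2_less_imp_less)
    qed
    then show "\<exists>N. \<forall>m\<ge>N. \<forall>n. norm (sum f {m..<n}) < e" by blast
  qed
  have "(\<lambda>n. (norm (sum f {..<n}))\<^sup>2) \<longlonglongrightarrow> (norm (suminf f))\<^sup>2"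
    by (intro tendsto_intros summable_LIMSEQ f)
  then show "(norm (suminf f))\<^sup>2 = (\<Sum>n. (norm (f n))\<^sup>2)"
    using LIMSEQ_unique[OF _ summable_LIMSEQ[OF sq]] by (simp add: pyth)
qed

lemma cinner_scaleC_right: "cinner x (c *\<^sub>C y) = cnj c * cinner x y"
  using cinner_commute[of x "c *\<^sub>C y"] cinner_commute[of x y] by simp

text \<open>
  This lets orthogonality be handled with the real inner product throughout: for a complex
  subspace, real orthogonality to all its elements already amounts to complex orthogonality.
\<close>

lemma inner_scaleC_left: "inner (c *\<^sub>C x) y = inner x (cnj c *\<^sub>C y)" for x y :: "'a :: complex_inner"
  by (simp add: inner_eq_Re_cinner cinner_scaleC_right)

lemma csubspace_imp_subspace:
  fixes S :: "'a :: complex_inner set"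
  shows "complex_vector.subspace S \<Longrightarrow> subspace S"
  by (simp add: subspace_def complex_vector.subspace_def scaleR_scaleC)

lemma closed_csubspace_sums:
  fixes S :: "'a :: complex_inner set"
  assumes "closed_csubspace S" "f sums s" "\<And>n. f n \<in> S"
  shows "s \<in> S"
proof (rule closed_sequentially)
  show "closed S" using assms(1) by (simp add: closed_csubspace_def)
  show "(\<lambda>n. sum f {..<n}) \<longlonglongrightarrow> s" using assms(2) by (simp add: sums_def)
  show "sum f {..<n} \<in> S" for n
    using assms(1,3) by (auto simp: closed_csubspace_def intro: complex_vector.subspace_sum)
qed

section \<open>Evaluation on the disc and the shift\<close>

lemma hardy_eval_sums:
  "cmod z < 1 \<Longrightarrow> (\<lambda>n. z ^ n *\<^sub>C coeff_hardy f n) sums hardy_eval f z"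
  for f :: "'a :: chilbert_space hardy"
  unfolding hardy_eval_def by (rule summable_sums[OF summable_hardy_eval])

lemma hardy_eval_add:
  fixes f g :: "'a :: chilbert_space hardy"
  assumes "cmod z < 1"
  shows "hardy_eval (f + g) z = hardy_eval f z + hardy_eval g z"
  using sums_unique2[OF hardy_eval_sums[OF assms, of "f + g"]]
    sums_add[OF hardy_eval_sums[OF assms, of f] hardy_eval_sums[OF assms, of g]]
  by (simp add: plus_hardy.rep_eq scaleC_add_right)

lemma hardy_eval_scaleC:
  fixes f :: "'a :: chilbert_space hardy"
  assumes "cmod z < 1"
  shows "hardy_eval (c *\<^sub>C f) z = c *\<^sub>C hardy_eval f z"
  using sums_unique2[OF hardy_eval_sums[OF assms, of "c *\<^sub>C f"]]
    bounded_linear.sums[OF bounded_linear_scaleC[of c] hardy_eval_sums[OF assms, of f]]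
  by (simp add: scaleC_hardy.rep_eq mult.commute)

lemma hardy_eval_diff:
  fixes f g :: "'a :: chilbert_space hardy"
  assumes "cmod z < 1"
  shows "hardy_eval (f - g) z = hardy_eval f z - hardy_eval g z"
  using hardy_eval_add[OF assms, of "f - g" g] by simp

text \<open>
  The identity principle for power series.  The origin is excluded from the hypothesis so that
  it is inherited, after division by \<open>z\<close>, by the series with the first coefficient removed.
\<close>

lemma zero_power_series_coeff:
  fixes a :: "nat \<Rightarrow> complex"
  assumes "\<And>z. z \<noteq> 0 \<Longrightarrow> cmod z < 1 \<Longrightarrow> (\<lambda>n. a n * z ^ n) sums 0"
  shows "a n = 0"
  using assms
proof (induction n arbitrary: a)
  case (0 a)
  have "((\<lambda>z :: complex. 0) \<longlongrightarrow> a 0) (at 0)" by (rule powser_limit_0_strong[OF zero_less_one]) (rule 0)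
  then show ?case by (metis LIM_const_eq)
next
  case (Suc n a)
  have "((\<lambda>z :: complex. 0) \<longlongrightarrow> a 0) (at 0)" by (rule powser_limit_0_strong[OF zero_less_one]) (rule Suc.prems)
  then have a0: "a 0 = 0" by (metis LIM_const_eq)
  show ?case
  proof (rule Suc.IH[of "\<lambda>n. a (Suc n)"])
    fix z :: complex assume z: "z \<noteq> 0" "cmod z < 1"
    have "(\<lambda>n. a (Suc n) * z ^ Suc n) sums 0"
      using Suc.prems[OF z] sums_Suc_iff[of "\<lambda>n. a n * z ^ n" 0] a0 by simp
    then have "(\<lambda>n. inverse z * (a (Suc n) * z ^ Suc n)) sums (inverse z * 0)" by (rule sums_mult)
    moreover have "inverse z * (a (Suc n) * z ^ Suc n) = a (Suc n) * z ^ n" for n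
      using z(1) by (simp add: field_simps)
    ultimately show "(\<lambda>n. a (Suc n) * z ^ n) sums 0" by (simp only: mult_zero_right)
  qed
qed

text \<open>
  Pairing the difference with its own \<open>n\<close>-th coefficient \<open>e\<close> reduces the uniqueness of
  power series expansions to the scalar case.
\<close>

lemma hardy_eqI:
  fixes f g :: "'a :: chilbert_space hardy"
  assumes eq: "\<And>z. cmod z < 1 \<Longrightarrow> hardy_eval f z = hardy_eval g z"
  shows "f = g"
proof -
  have "coeff_hardy (f - g) n = 0" for n
  proof -
    define e where "e = coeff_hardy (f - g) n"
    have lin: "bounded_linear (\<lambda>x. cinner x e)"
      by (rule bounded_linear_intro[where K = "norm e"])
        (simp_all add: cinner_add_left scaleR_scaleC scaleC_complex_def norm_cinner_le)
    have "cinner (coeff_hardy (f - g) n) e = 0"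
    proof (rule zero_power_series_coeff[of "\<lambda>n. cinner (coeff_hardy (f - g) n) e"])
      fix z :: complex assume z: "cmod z < 1"
      have "hardy_eval (f - g) z = 0" using eq[OF z] by (simp add: hardy_eval_diff[OF z])
      then show "(\<lambda>n. cinner (coeff_hardy (f - g) n) e * z ^ n) sums 0"
        using bounded_linear.sums[OF lin hardy_eval_sums[OF z, of "f - g"]] linear_0[OF bounded_linear.linear[OF lin]]
        by (simp add: mult.commute)
    qed
    then show ?thesis by (simp add: cinner_self flip: e_def)
  qed
  then show ?thesis
    by (simp add: coeff_hardy_diff coeff_hardy_inject[symmetric] fun_eq_iff)
qed

text \<open>
  The Szego kernel in the direction \<open>x\<close>, that is, the function
  \<open>\<lambda>z. (1 / (1 - z * cnj w)) *\<^sub>C x\<close>.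
\<close>

lemma szego_kernel_exists:
  fixes x :: "'a :: chilbert_space"
  assumes w: "cmod w < 1"
  shows "\<exists>k. coeff_hardy k = (\<lambda>n. cnj w ^ n *\<^sub>C x) \<and> (norm k)\<^sup>2 = (norm x)\<^sup>2 / (1 - (cmod w)\<^sup>2) \<and>
    hardy_eval k w = (1 / (1 - (cmod w)\<^sup>2)) *\<^sub>R x"
proof -
  have r: "norm ((cmod w)\<^sup>2) < 1" using w by (simp add: abs_square_less_1)
  have sq: "(norm (cnj w ^ n *\<^sub>C x))\<^sup>2 = (norm x)\<^sup>2 * ((cmod w)\<^sup>2) ^ n" for n
    by (simp add: norm_power power_mult_distrib mult.commute flip: power_mult)
  have "summable (\<lambda>n. (norm (cnj w ^ n *\<^sub>C x))\<^sup>2)"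
    unfolding sq by (intro summable_mult summable_geometric r)
  then obtain k where k: "coeff_hardy k = (\<lambda>n. cnj w ^ n *\<^sub>C x)"
    by (metis Abs_hardy_inverse mem_Collect_eq)
  have "(norm k)\<^sup>2 = (norm x)\<^sup>2 / (1 - (cmod w)\<^sup>2)"
    unfolding norm_hardy_sq k sq using suminf_mult[OF summable_geometric[OF r]] suminf_geometric[OF r] by simp
  moreover have "hardy_eval k w = (1 / (1 - (cmod w)\<^sup>2)) *\<^sub>R x"
  proof -
    have "w ^ n *\<^sub>C coeff_hardy k n = ((cmod w)\<^sup>2) ^ n *\<^sub>R x" for n
      by (simp add: k scaleR_scaleC flip: power_mult_distrib complex_norm_square)
    moreover have "(\<lambda>n. ((cmod w)\<^sup>2) ^ n *\<^sub>R x) sums ((1 / (1 - (cmod w)\<^sup>2)) *\<^sub>R x)"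
      by (intro sums_scaleR_left geometric_sums r)
    ultimately show ?thesis using hardy_eval_sums[OF w, of k] sums_unique2 by fastforce
  qed
  ultimately show ?thesis using k by blast
qed

text \<open>
  The inner product of \<open>f\<close> with the Szego kernel at \<open>w\<close> in the direction \<open>x\<close> is
  \<open>inner (hardy_eval f w) x\<close>; choosing \<open>x = hardy_eval f w\<close>, the Cauchy-Schwarz inequality
  gives the sharp bound for point evaluation.
\<close>

lemma norm_hardy_eval_sq_le:
  fixes f :: "'a :: chilbert_space hardy"
  assumes w: "cmod w < 1"
  shows "(norm (hardy_eval f w))\<^sup>2 \<le> (norm f)\<^sup>2 / (1 - (cmod w)\<^sup>2)"
proof -
  define x where "x = hardy_eval f w"
  obtain k where k: "coeff_hardy k = (\<lambda>n. cnj w ^ n *\<^sub>C x)" "(norm k)\<^sup>2 = (norm x)\<^sup>2 / (1 - (cmod w)\<^sup>2)"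
    using szego_kernel_exists[OF w] by blast
  have pos: "0 < 1 - (cmod w)\<^sup>2" using w by (simp add: abs_square_less_1)
  have "inner f k = (\<Sum>n. inner (coeff_hardy f n) (coeff_hardy k n))"
    unfolding inner_hardy_def cinner_hardy_def inner_eq_Re_cinner
    by (rule Re_suminf[OF summable_cinner_coeff])
  also have "\<dots> = (\<Sum>n. inner (w ^ n *\<^sub>C coeff_hardy f n) x)"
    by (simp add: k inner_scaleC_left)
  also have "\<dots> = inner x x"
    using bounded_linear.sums[OF bounded_linear_inner_left[of x] hardy_eval_sums[OF w, of f]]
    by (simp add: x_def sums_iff)
  finally have "(norm x)\<^sup>2 \<le> norm f * norm k"
    using norm_cauchy_schwarz[of f k] by (simp add: power2_norm_eq_inner)
  then have "((norm x)\<^sup>2)\<^sup>2 \<le> (norm f)\<^sup>2 * ((norm x)\<^sup>2 / (1 - (cmod w)\<^sup>2))"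
    using power_mono[of "(norm x)\<^sup>2" "norm f * norm k" 2] by (simp add: power_mult_distrib k(2))
  then have "(norm x)\<^sup>2 * (norm x)\<^sup>2 \<le> (norm f)\<^sup>2 / (1 - (cmod w)\<^sup>2) * (norm x)\<^sup>2"
    by (simp add: power2_eq_square)
  then have "(norm x)\<^sup>2 \<le> (norm f)\<^sup>2 / (1 - (cmod w)\<^sup>2)"
  proof (cases "x = 0")
    case False
    then show ?thesis
      by (intro mult_right_le_imp_le[OF \<open>(norm x)\<^sup>2 * (norm x)\<^sup>2 \<le> _\<close>]) simp
  qed (use pos in simp)
  then show ?thesis by (simp add: x_def)
qed

lemma bounded_linear_hardy_eval:
  assumes z: "cmod z < 1"
  shows "bounded_linear (\<lambda>f :: 'a :: chilbert_space hardy. hardy_eval f z)"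
proof (rule bounded_linear_intro[where K = "1 / sqrt (1 - (cmod z)\<^sup>2)"])
  have pos: "0 < 1 - (cmod z)\<^sup>2" using z by (simp add: abs_square_less_1)
  fix f :: "'a hardy"
  have "norm (hardy_eval f z) \<le> sqrt ((norm f)\<^sup>2 / (1 - (cmod z)\<^sup>2))"
    by (rule real_le_rsqrt[OF norm_hardy_eval_sq_le[OF z]])
  then show "norm (hardy_eval f z) \<le> norm f * (1 / sqrt (1 - (cmod z)\<^sup>2))"
    by (simp add: real_sqrt_divide)
qed (simp_all add: scaleR_scaleC hardy_eval_add[OF z] hardy_eval_scaleC[OF z])

lemma hardy_on_zero: "hardy_on {0} = {0}"
proof -
  have "f = 0 \<longleftrightarrow> (\<forall>n. coeff_hardy f n = 0)" for f :: "'a hardy"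
    using coeff_hardy_inject[of f 0] by (simp add: zero_hardy.rep_eq fun_eq_iff)
  then show ?thesis by (simp add: hardy_on_def set_eq_iff)
qed

lemma hardy_shift_add: "hardy_shift (f + g) = hardy_shift f + hardy_shift g"
  by transfer (auto simp: fun_eq_iff split: nat.split)

lemma hardy_shift_scaleC: "hardy_shift (c *\<^sub>C f) = c *\<^sub>C hardy_shift f"
  by transfer (auto simp: fun_eq_iff split: nat.split)

lemma hardy_shift_inner [simp]: "inner (hardy_shift f) (hardy_shift g) = inner f g"
proof -
  have "cinner (hardy_shift f) (hardy_shift g) = cinner f g"
    using suminf_split_head[OF summable_cinner_coeff[of "hardy_shift f" "hardy_shift g"]]
      cinner_scaleC_left[of 0 "0 :: 'a" 0]
    by (simp add: cinner_hardy_def hardy_shift.rep_eq)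
  then show ?thesis by (simp add: inner_eq_Re_cinner)
qed

lemma norm_hardy_shift [simp]: "norm (hardy_shift f) = norm f"
  by (simp add: norm_eq_sqrt_inner)

lemma bounded_linear_hardy_shift: "bounded_linear hardy_shift"
  by (rule bounded_linear_intro[where K = 1])
    (simp_all add: hardy_shift_add hardy_shift_scaleC scaleR_scaleC)

lemma inner_hardy_shift_funpow:
  "inner ((hardy_shift ^^ n) f) ((hardy_shift ^^ n) g) = inner f g"
  by (induction n) auto

lemma hardy_eval_shift_funpow:
  fixes f :: "'a :: chilbert_space hardy"
  assumes "cmod z < 1"
  shows "hardy_eval ((hardy_shift ^^ n) f) z = z ^ n *\<^sub>C hardy_eval f z"
  by (induction n) (simp_all add: hardy_eval_shift[OF assms])

section \<open>The wandering subspace\<close>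

definition wandering :: "'a :: complex_inner hardy set \<Rightarrow> 'a hardy set" where
  "wandering N = {x \<in> N. \<forall>y\<in>N. inner x (hardy_shift y) = 0}"

lemma closed_csubspace_wandering:
  assumes "closed_csubspace N"
  shows "closed_csubspace (wandering N)"
proof -
  have N: "complex_vector.subspace N" "closed N" using assms by (auto simp: closed_csubspace_def)
  have "wandering N = N \<inter> (\<Inter>y\<in>N. {x. inner x (hardy_shift y) = 0})"
    by (auto simp: wandering_def)
  then have "closed (wandering N)"
    by (auto intro!: closed_Int closed_INT N(2) closed_Collect_eq continuous_intros)
  moreover have "complex_vector.subspace (wandering N)"
    using N(1)
    by (auto simp: complex_vector.subspace_def wandering_def inner_add_left inner_scaleC_left
        simp flip: hardy_shift_scaleC)
  ultimately show ?thesis by (simp add: closed_csubspace_def)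
qed

text \<open>
  The Wold decomposition step.  The shift, being isometric, maps \<open>N\<close> onto a closed subspace,
  so every element of \<open>N\<close> has a projection onto \<open>S N\<close>.
\<close>

lemma wandering_decomposition:
  fixes N :: "'a :: chilbert_space hardy set"
  assumes N: "closed_csubspace N" and inv: "hardy_shift ` N \<subseteq> N" and "h \<in> N"
  shows "\<exists>w\<in>wandering N. \<exists>h'\<in>N. h = w + hardy_shift h'"
proof -
  have sub: "subspace N" and "closed N"
    using N by (auto simp: closed_csubspace_def intro: csubspace_imp_subspace)
  have "subspace (hardy_shift ` N)"
    by (rule linear_subspace_image[OF bounded_linear.linear[OF bounded_linear_hardy_shift] sub])
  moreover have "closed (hardy_shift ` N)"
    using complete_isometric_image[OF zero_less_one sub bounded_linear_hardy_shift] \<open>closed N\<close>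
    by (simp add: complete_eq_closed)
  ultimately obtain p where p: "p \<in> hardy_shift ` N" "\<forall>y\<in>hardy_shift ` N. inner (h - p) y = 0"
    using orthogonal_decomposition_exists by blast
  then have "h - p \<in> wandering N"
    using inv \<open>h \<in> N\<close> sub by (auto simp: wandering_def intro: subspace_diff)
  then show ?thesis using p(1) by (metis diff_add_cancel imageE)
qed

lemma hardy_shift_funpow_mem: "hardy_shift ` N \<subseteq> N \<Longrightarrow> x \<in> N \<Longrightarrow> (hardy_shift ^^ n) x \<in> N"
  by (induction n) auto

text \<open>
  Since the shift preserves inner products, \<open>m\<close> common shifts cancel; what remains is
  \<open>x\<close> against an element of \<open>S N\<close>.
\<close>

lemma wandering_orthogonal:
  assumes inv: "hardy_shift ` N \<subseteq> N" and x: "x \<in> wandering N" and y: "y \<in> wandering N" and "m < n"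
  shows "inner ((hardy_shift ^^ m) x) ((hardy_shift ^^ n) y) = 0"
proof -
  define k where "k = n - Suc m"
  have n: "n = m + Suc k" using \<open>m < n\<close> by (simp add: k_def)
  have "(hardy_shift ^^ k) y \<in> N"
    using hardy_shift_funpow_mem[OF inv] y by (simp add: wandering_def)
  then have "inner x ((hardy_shift ^^ Suc k) y) = 0" using x by (simp add: wandering_def)
  then show ?thesis unfolding n funpow_add comp_apply inner_hardy_shift_funpow .
qed

text \<open>
  The required element is \<open>\<Sum>n. S\<^sup>n w\<^sub>n\<close>.  Here \<open>w\<close> is a Hardy function whose values are
  Hardy functions, and the value at \<open>z\<close> of its value at \<open>z\<close> is what multiplication by the
  evaluation symbol produces.
\<close>

lemma wandering_synthesis:
  fixes N :: "'a :: chilbert_space hardy set"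
  assumes N: "closed_csubspace N" and inv: "hardy_shift ` N \<subseteq> N" and w: "w \<in> hardy_on (wandering N)"
  shows "\<exists>g\<in>N. norm g = norm w \<and> (\<forall>z\<in>ball 0 1. hardy_eval g z = hardy_eval (hardy_eval w z) z)"
proof -
  define u where "u n = (hardy_shift ^^ n) (coeff_hardy w n)" for n
  have W: "coeff_hardy w n \<in> wandering N" for n using w by (simp add: hardy_on_def)
  have orth: "inner (u m) (u n) = 0" if "m \<noteq> n" for m n
    using that wandering_orthogonal[OF inv W W, of m n] wandering_orthogonal[OF inv W W, of n m]
    by (cases m n rule: linorder_cases) (auto simp: u_def inner_commute)
  have norm_u: "norm (u n) = norm (coeff_hardy w n)" for n
    by (simp add: u_def norm_eq_sqrt_inner inner_hardy_shift_funpow)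
  have sq: "summable (\<lambda>n. (norm (u n))\<^sup>2)" unfolding norm_u by (rule summable_coeff_sq)
  note u = orthogonal_series[OF orth sq]
  have "suminf u \<in> N"
    using W by (intro closed_csubspace_sums[OF N summable_sums[OF u(1)]])
      (auto simp: u_def wandering_def intro: hardy_shift_funpow_mem[OF inv])
  moreover have "norm (suminf u) = norm w"
    using u(2) by (simp add: norm_u power2_eq_iff_nonneg flip: norm_hardy_sq)
  moreover have "hardy_eval (suminf u) z = hardy_eval (hardy_eval w z) z" if "z \<in> ball 0 1" for z
  proof -
    have z: "cmod z < 1" using that by simp
    note ev = bounded_linear.sums[OF bounded_linear_hardy_eval[OF z]]
    have "(\<lambda>n. hardy_eval (u n) z) sums hardy_eval (suminf u) z"
      by (rule ev[OF summable_sums[OF u(1)]])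
    moreover have "(\<lambda>n. hardy_eval (z ^ n *\<^sub>C coeff_hardy w n) z) sums hardy_eval (hardy_eval w z) z"
      by (rule ev[OF hardy_eval_sums[OF z]])
    ultimately show ?thesis
      by (simp add: u_def hardy_eval_shift_funpow[OF z] hardy_eval_scaleC[OF z] sums_unique2)
  qed
  ultimately show ?thesis by blast
qed

text \<open>
  Iterating the decomposition \<open>h = w\<^sub>0 + S h\<^sub>1\<close> produces the coefficients.  The Pythagorean theorem
  makes them square-summable and keeps the remainders \<open>h\<^sub>n\<close> bounded by \<open>norm h\<close>.  It is
  enough to compare values at points of the disc, where the factor \<open>z\<^sup>n\<close> kills the remainder.
\<close>

lemma wandering_analysis:
  fixes N :: "'a :: chilbert_space hardy set"
  assumes N: "closed_csubspace N" and inv: "hardy_shift ` N \<subseteq> N" and h: "h \<in> N"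
  shows "\<exists>w\<in>hardy_on (wandering N). \<forall>z\<in>ball 0 1. hardy_eval h z = hardy_eval (hardy_eval w z) z"
proof -
  obtain a b where a: "\<And>f. f \<in> N \<Longrightarrow> a f \<in> wandering N"
    and b: "\<And>f. f \<in> N \<Longrightarrow> b f \<in> N"
    and ab: "\<And>f. f \<in> N \<Longrightarrow> f = a f + hardy_shift (b f)"
    using wandering_decomposition[OF N inv] by metis
  define r where "r n = (b ^^ n) h" for n
  define c where "c n = a (r n)" for n
  have r0: "r 0 = h" by (simp add: r_def)
  have rN: "r n \<in> N" for n by (induction n) (simp_all add: r_def h b)
  have cW: "c n \<in> wandering N" for n by (simp add: c_def a rN)
  have r_step: "r n = c n + hardy_shift (r (Suc n))" for n
    using ab[OF rN] unfolding c_def by (simp only: r_def funpow.simps comp_apply)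
  have step: "(norm (r n))\<^sup>2 = (norm (c n))\<^sup>2 + (norm (r (Suc n)))\<^sup>2" for n
  proof -
    have "inner (c n) (hardy_shift (r (Suc n))) = 0" using cW rN by (simp add: wandering_def)
    then show ?thesis
      using norm_add_Pythagorean[of "c n" "hardy_shift (r (Suc n))"] r_step[of n]
      by (simp add: orthogonal_def)
  qed
  have energy: "(norm h)\<^sup>2 = (\<Sum>k<n. (norm (c k))\<^sup>2) + (norm (r n))\<^sup>2" for n
  proof (induction n)
    case (Suc n)
    then show ?case using step[of n] by simp
  qed (simp add: r0)
  have "(\<Sum>k<n. (norm (c k))\<^sup>2) \<le> (norm h)\<^sup>2" for n using energy[of n] by simp
  then have "summable (\<lambda>n. (norm (c n))\<^sup>2)"
    by (intro summableI_nonneg_bounded[where x = "(norm h)\<^sup>2"]) auto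
  then obtain w where w: "coeff_hardy w = c" by (metis Abs_hardy_inverse mem_Collect_eq)
  have rh: "norm (r n) \<le> norm h" for n
    by (rule power2_le_imp_le) (use energy[of n] in \<open>simp_all add: sum_nonneg\<close>)
  have "hardy_eval h z = hardy_eval (hardy_eval w z) z" if "z \<in> ball 0 1" for z
  proof -
    have z: "cmod z < 1" using that by simp
    obtain K where K: "\<And>f :: 'a hardy. norm (hardy_eval f z) \<le> norm f * K" "0 < K"
      using bounded_linear.pos_bounded[OF bounded_linear_hardy_eval[OF z]] by blast
    have partial: "hardy_eval h z = (\<Sum>k<n. z ^ k *\<^sub>C hardy_eval (c k) z) + z ^ n *\<^sub>C hardy_eval (r n) z" for n
    proof (induction n)
      case (Suc n)
      have "hardy_eval (r n) z = hardy_eval (c n) z + z *\<^sub>C hardy_eval (r (Suc n)) z"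
        by (subst r_step) (simp only: hardy_eval_add[OF z] hardy_eval_shift[OF z])
      then show ?case using Suc by (simp add: scaleC_add_right algebra_simps)
    qed (simp add: r0)
    have "(\<lambda>n. z ^ n *\<^sub>C hardy_eval (r n) z) \<longlonglongrightarrow> 0"
    proof (rule Lim_null_comparison)
      show "\<forall>\<^sub>F n in sequentially. norm (z ^ n *\<^sub>C hardy_eval (r n) z) \<le> cmod z ^ n * (norm h * K)"
      proof (intro always_eventually allI)
        fix n
        have "norm (hardy_eval (r n) z) \<le> norm h * K"
          using K(1)[of "r n"] mult_right_mono[OF rh[of n], of K] K(2) by linarith
        then show "norm (z ^ n *\<^sub>C hardy_eval (r n) z) \<le> cmod z ^ n * (norm h * K)"
          by (simp add: norm_power mult_left_mono)
      qed
      show "(\<lambda>n. cmod z ^ n * (norm h * K)) \<longlonglongrightarrow> 0"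
        using z by (intro tendsto_mult_left_zero LIMSEQ_power_zero) simp
    qed
    then have "(\<lambda>n. hardy_eval h z - z ^ n *\<^sub>C hardy_eval (r n) z) \<longlonglongrightarrow> hardy_eval h z - 0"
      by (intro tendsto_intros)
    moreover have "hardy_eval h z - z ^ n *\<^sub>C hardy_eval (r n) z = (\<Sum>k<n. z ^ k *\<^sub>C hardy_eval (c k) z)" for n
      using partial[of n] by simp
    ultimately have "(\<lambda>n. z ^ n *\<^sub>C hardy_eval (c n) z) sums hardy_eval h z"
      by (simp add: sums_def)
    moreover have "(\<lambda>n. hardy_eval (z ^ n *\<^sub>C c n) z) sums hardy_eval (hardy_eval w z) z"
      unfolding w[symmetric] by (rule bounded_linear.sums[OF bounded_linear_hardy_eval[OF z] hardy_eval_sums[OF z]])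
    ultimately show ?thesis by (simp add: hardy_eval_scaleC[OF z] sums_unique2)
  qed
  moreover have "w \<in> hardy_on (wandering N)" using w cW by (simp add: hardy_on_def)
  ultimately show ?thesis by blast
qed

section \<open>Multiplication by an inner function\<close>

lemma mult_op_eqI:
  assumes "\<And>z. cmod z < 1 \<Longrightarrow> hardy_eval g z = \<Phi> z (hardy_eval f z)"
  shows "mult_op \<Phi> f = g"
  unfolding mult_op_def
proof (rule the_equality)
  show "\<forall>z\<in>ball 0 1. hardy_eval g z = \<Phi> z (hardy_eval f z)" using assms by simp
  show "g' = g" if "\<forall>z\<in>ball 0 1. hardy_eval g' z = \<Phi> z (hardy_eval f z)" for g'
    by (rule hardy_eqI) (use that assms in simp)
qed

lemma hardy_eval_mem:
  fixes F :: "'a :: chilbert_space set"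
  assumes F: "closed_csubspace F" and f: "f \<in> hardy_on F" and z: "cmod z < 1"
  shows "hardy_eval f z \<in> F"
  using F f by (intro closed_csubspace_sums[OF F hardy_eval_sums[OF z]])
    (auto simp: closed_csubspace_def hardy_on_def intro: complex_vector.subspace_scale)

text \<open>
  The product \<open>\<Phi> f\<close> lies in the Hardy space, so \<open>mult_op\<close> has its intended values.  Norm
  preservation alone forces this.  If the product with \<open>f\<close> were not represented by a Hardy
  function, neither would be the product with \<open>2 f\<close>, and the description in \<open>mult_op\<close> would
  be unsatisfiable for both.  It would then denote one and the same default element, whose norm
  would be both \<open>norm f\<close> and \<open>2 * norm f\<close>; so \<open>f = 0\<close>, whose product with \<open>\<Phi>\<close> is
  represented by \<open>0\<close>, a contradiction.
\<close>

lemma hardy_eval_mult_op: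
  fixes \<Phi> :: "complex \<Rightarrow> 'b :: chilbert_space \<Rightarrow> 'a :: chilbert_space"
  assumes F: "closed_csubspace F" and \<Phi>: "inner_function F \<Phi>" and f: "f \<in> hardy_on F"
    and z: "cmod z < 1"
  shows "hardy_eval (mult_op \<Phi> f) z = \<Phi> z (hardy_eval f z)"
proof -
  define represents where
    "represents g f \<longleftrightarrow> (\<forall>z\<in>ball 0 1. hardy_eval g z = \<Phi> z (hardy_eval f z))" for g f
  \<comment> \<open>The value of an unsatisfiable definite description.\<close>
  define c :: "'a hardy" where "c = (THE g. False)"
  have scale: "\<Phi> z (a *\<^sub>C x) = a *\<^sub>C \<Phi> z x" if "cmod z < 1" "x \<in> F" for z a x
    using \<Phi> that by (simp add: inner_function_def Hinfty_def bounded_clinear_on_def)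
  have iso: "norm (mult_op \<Phi> f) = norm f" if "f \<in> hardy_on F" for f
    using \<Phi> that by (simp add: inner_function_def)
  have "\<exists>g. represents g f"
  proof (rule ccontr)
    assume none: "\<nexists>g. represents g f"
    have f2: "2 *\<^sub>C f \<in> hardy_on F"
      using F f by (auto simp: hardy_on_def closed_csubspace_def scaleC_hardy.rep_eq
          intro: complex_vector.subspace_scale)
    have none2: "\<nexists>g. represents g (2 *\<^sub>C f)"
    proof
      assume "\<exists>g. represents g (2 *\<^sub>C f)"
      then obtain g where g: "represents g (2 *\<^sub>C f)" ..
      have "represents ((1/2) *\<^sub>C g) f"
        unfolding represents_def
      proof
        fix z :: complex assume "z \<in> ball 0 1"
        then have z: "cmod z < 1" by simp
        then have "hardy_eval g z = \<Phi> z (2 *\<^sub>C hardy_eval f z)"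
          using g by (simp add: represents_def hardy_eval_scaleC)
        then show "hardy_eval ((1/2) *\<^sub>C g) z = \<Phi> z (hardy_eval f z)"
          by (simp add: hardy_eval_scaleC[OF z] scale[OF z hardy_eval_mem[OF F f z]])
      qed
      with none show False by blast
    qed
    have "mult_op \<Phi> f = c" if "\<nexists>g. represents g f" for f
      using that by (simp add: mult_op_def c_def flip: represents_def)
    then have "norm f = norm (2 *\<^sub>C f)" using iso[OF f] iso[OF f2] none none2 by simp
    then have "f = 0" by simp
    have "represents 0 f"
      unfolding represents_def
    proof
      fix z :: complex assume "z \<in> ball 0 1"
      then have z: "cmod z < 1" by simp
      have "hardy_eval (0 :: 'a hardy) z = 0" "hardy_eval f z = 0"
        using hardy_eval_diff[OF z, of "0 :: 'a hardy" 0] hardy_eval_diff[OF z, of f f] \<open>f = 0\<close>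
        by simp_all
      then show "hardy_eval (0 :: 'a hardy) z = \<Phi> z (hardy_eval f z)"
        using scale[OF z hardy_eval_mem[OF F f z], of 0] by simp
    qed
    with none show False by blast
  qed
  then obtain g where g: "represents g f" ..
  then have "mult_op \<Phi> f = g" by (intro mult_op_eqI) (simp add: represents_def)
  with g z show ?thesis by (simp add: represents_def)
qed

lemma mult_op_hardy_shift:
  fixes \<Phi> :: "complex \<Rightarrow> 'b :: chilbert_space \<Rightarrow> 'a :: chilbert_space"
  assumes F: "closed_csubspace F" and \<Phi>: "inner_function F \<Phi>" and f: "f \<in> hardy_on F"
  shows "mult_op \<Phi> (hardy_shift f) = hardy_shift (mult_op \<Phi> f)"
proof (rule mult_op_eqI)
  fix z :: complex assume z: "cmod z < 1"
  have "\<Phi> z (z *\<^sub>C hardy_eval f z) = z *\<^sub>C \<Phi> z (hardy_eval f z)"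
    using \<Phi> z hardy_eval_mem[OF F f z]
    by (simp add: inner_function_def Hinfty_def bounded_clinear_on_def)
  then show "hardy_eval (hardy_shift (mult_op \<Phi> f)) z = \<Phi> z (hardy_eval (hardy_shift f) z)"
    by (simp add: hardy_eval_shift[OF z] hardy_eval_mult_op[OF F \<Phi> f z])
qed

lemma range_mult_op_shift_invariant:
  assumes F: "closed_csubspace F" and \<Phi>: "inner_function F \<Phi>"
  shows "hardy_shift ` mult_op \<Phi> ` hardy_on F \<subseteq> mult_op \<Phi> ` hardy_on F"
proof clarify
  fix f assume f: "f \<in> hardy_on F"
  then have "hardy_shift f \<in> hardy_on F"
    using F by (auto simp: hardy_on_def hardy_shift.rep_eq closed_csubspace_def
        intro: complex_vector.subspace_0 split: nat.split)
  then show "hardy_shift (mult_op \<Phi> f) \<in> mult_op \<Phi> ` hardy_on F"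
    using mult_op_hardy_shift[OF F \<Phi> f] by (metis imageI)
qed

section \<open>Beurling-Lax representation\<close>

text \<open>
  A symbol whose multiplication operator is isometric is contractive at every point of the disc.
  With \<open>k\<close> the Szego kernel at \<open>w\<close> in the direction \<open>x\<close>, the product takes the value
  \<open>s *\<^sub>R \<Phi> w x\<close> at \<open>w\<close>, where \<open>s = 1 / (1 - (cmod w)\<^sup>2)\<close>, and has squared norm
  \<open>s * (norm x)\<^sup>2\<close>.  The sharp bound for point evaluation loses exactly one more factor
  \<open>s\<close>, so the factors cancel.
\<close>

lemma norm_mult_symbol_le:
  fixes \<Phi> :: "complex \<Rightarrow> 'b :: chilbert_space \<Rightarrow> 'a :: chilbert_space"
  assumes F: "closed_csubspace F"
    and scale: "\<And>c x. x \<in> F \<Longrightarrow> \<Phi> w (c *\<^sub>C x) = c *\<^sub>C \<Phi> w x"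
    and mult: "\<And>f. f \<in> hardy_on F \<Longrightarrow> \<exists>g. norm g = norm f \<and> hardy_eval g w = \<Phi> w (hardy_eval f w)"
    and x: "x \<in> F" and w: "cmod w < 1"
  shows "norm (\<Phi> w x) \<le> norm x"
proof -
  define s where "s = 1 / (1 - (cmod w)\<^sup>2)"
  have s: "s > 0" using w by (simp add: s_def abs_square_less_1)
  obtain k where k: "coeff_hardy k = (\<lambda>n. cnj w ^ n *\<^sub>C x)" "(norm k)\<^sup>2 = (norm x)\<^sup>2 * s"
    "hardy_eval k w = s *\<^sub>R x"
    using szego_kernel_exists[OF w, of x] by (auto simp: s_def)
  have "k \<in> hardy_on F"
    using F x by (auto simp: hardy_on_def k closed_csubspace_def intro: complex_vector.subspace_scale)
  then obtain g where g: "norm g = norm k" "hardy_eval g w = s *\<^sub>R \<Phi> w x"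
    using mult scale[OF x] by (metis k(3) scaleR_scaleC)
  have "(norm (hardy_eval g w))\<^sup>2 \<le> (norm g)\<^sup>2 * s"
    using norm_hardy_eval_sq_le[OF w, of g] by (simp add: s_def)
  then have "s * s * (norm (\<Phi> w x))\<^sup>2 \<le> s * s * (norm x)\<^sup>2"
    by (simp add: g k(2) power_mult_distrib power2_eq_square[of s] mult_ac)
  then have "(norm (\<Phi> w x))\<^sup>2 \<le> (norm x)\<^sup>2" using s by simp
  then show ?thesis by (rule power2_le_imp_le) simp
qed

text \<open>
  The operator coefficients of evaluation are the coefficient maps, which are contractions; the
  tail of the expansion is therefore dominated by that of the geometric series.
\<close>

lemma analytic_op_hardy_eval:
  "analytic_op_on_disc F (\<lambda>z (x :: 'a :: chilbert_space hardy). hardy_eval x z)"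
  unfolding analytic_op_on_disc_def
proof (intro exI[of _ "\<lambda>n x. coeff_hardy x n"] conjI allI ballI impI)
  show "bounded_clinear_on F (\<lambda>x. coeff_hardy x n)" for n
    unfolding bounded_clinear_on_def
    by (auto simp: plus_hardy.rep_eq scaleC_hardy.rep_eq intro!: exI[of _ 1] norm_coeff_le)
  fix z :: complex and \<epsilon> :: real assume "z \<in> ball 0 1" and \<epsilon>: "0 < \<epsilon>"
  then have z: "cmod z < 1" by simp
  have geo: "(\<lambda>k. cmod z ^ k) sums (1 / (1 - cmod z))" using z by (simp add: geometric_sums)
  have "(\<lambda>n. (1 / (1 - cmod z)) - (\<Sum>k<n. cmod z ^ k)) \<longlonglongrightarrow> (1 / (1 - cmod z)) - (1 / (1 - cmod z))"
    using geo unfolding sums_def by (intro tendsto_intros)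
  then have "\<forall>\<^sub>F n in sequentially. (1 / (1 - cmod z)) - (\<Sum>k<n. cmod z ^ k) < \<epsilon>"
    using \<epsilon> by (intro order_tendstoD(2)) auto
  then obtain N where N: "\<And>n. n \<ge> N \<Longrightarrow> (1 / (1 - cmod z)) - (\<Sum>k<n. cmod z ^ k) < \<epsilon>"
    by (auto simp: eventually_sequentially)
  have "norm (hardy_eval x z - (\<Sum>k<n. z ^ k *\<^sub>C coeff_hardy x k)) \<le> \<epsilon> * norm x" if "n \<ge> N" for n x
  proof -
    note tail = sums_split_initial_segment[of _ _ n]
    have "norm (hardy_eval x z - (\<Sum>k<n. z ^ k *\<^sub>C coeff_hardy x k))
        \<le> norm x * ((1 / (1 - cmod z)) - (\<Sum>k<n. cmod z ^ k))"
    proof (rule norm_sums_le[OF tail[OF hardy_eval_sums[OF z]] sums_mult[OF tail[OF geo]]])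
      show "norm (z ^ (k + n) *\<^sub>C coeff_hardy x (k + n)) \<le> norm x * cmod z ^ (k + n)" for k
        using mult_right_mono[OF norm_coeff_le[of x "k + n"], of "cmod z ^ (k + n)"]
        by (simp add: norm_power mult.commute)
    qed
    also have "\<dots> \<le> norm x * \<epsilon>" using N[OF that] by (intro mult_left_mono) auto
    finally show ?thesis by (simp add: mult.commute)
  qed
  then show "\<exists>N. \<forall>n\<ge>N. \<forall>x\<in>F. norm (hardy_eval x z - (\<Sum>k<n. z ^ k *\<^sub>C coeff_hardy x k)) \<le> \<epsilon> * norm x"
    by blast
qed

theorem beurling_lax:
  fixes N :: "'a :: chilbert_space hardy set"
  assumes N: "closed_csubspace N" and inv: "hardy_shift ` N \<subseteq> N"
  defines "\<Phi> \<equiv> \<lambda>z (x :: 'a hardy). hardy_eval x z"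
  shows "inner_function (wandering N) \<Phi>" and "N = mult_op \<Phi> ` hardy_on (wandering N)"
proof -
  note W = closed_csubspace_wandering[OF N]
  have mult: "mult_op \<Phi> w \<in> N \<and> norm (mult_op \<Phi> w) = norm w \<and>
      (\<forall>z\<in>ball 0 1. hardy_eval (mult_op \<Phi> w) z = \<Phi> z (hardy_eval w z))"
    if w: "w \<in> hardy_on (wandering N)" for w
  proof -
    obtain g where g: "g \<in> N" "norm g = norm w" "\<And>z. z \<in> ball 0 1 \<Longrightarrow> hardy_eval g z = hardy_eval (hardy_eval w z) z"
      using wandering_synthesis[OF N inv w] by blast
    moreover from g(3) have "mult_op \<Phi> w = g" by (intro mult_op_eqI) (simp add: \<Phi>_def)
    ultimately show ?thesis by (simp add: \<Phi>_def)
  qed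
  have bound: "norm (\<Phi> z x) \<le> 1 * norm x" if "z \<in> ball 0 1" "x \<in> wandering N" for z x
  proof -
    have z: "cmod z < 1" using that(1) by simp
    have "norm (\<Phi> z x) \<le> norm x"
    proof (rule norm_mult_symbol_le[OF W _ _ that(2) z])
      show "\<Phi> z (c *\<^sub>C x) = c *\<^sub>C \<Phi> z x" for c x by (simp add: \<Phi>_def hardy_eval_scaleC[OF z])
      show "\<exists>g. norm g = norm f \<and> hardy_eval g z = \<Phi> z (hardy_eval f z)"
        if "f \<in> hardy_on (wandering N)" for f
        using mult[OF that] z by auto
    qed
    then show ?thesis by simp
  qed
  have "bounded_clinear_on (wandering N) (\<Phi> z)" if "z \<in> ball 0 1" for z
    unfolding bounded_clinear_on_def using bound[OF that] that
    by (intro conjI exI[of _ 1]) (auto simp: \<Phi>_def hardy_eval_add hardy_eval_scaleC)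
  moreover have "analytic_op_on_disc (wandering N) \<Phi>"
    unfolding \<Phi>_def by (rule analytic_op_hardy_eval)
  ultimately have "\<Phi> \<in> Hinfty (wandering N)" unfolding Hinfty_def using bound by blast
  then show "inner_function (wandering N) \<Phi>" unfolding inner_function_def using mult by blast
  show "N = mult_op \<Phi> ` hardy_on (wandering N)"
  proof
    show "N \<subseteq> mult_op \<Phi> ` hardy_on (wandering N)"
    proof
      fix h assume "h \<in> N"
      then obtain w where w: "w \<in> hardy_on (wandering N)"
        "\<And>z. z \<in> ball 0 1 \<Longrightarrow> hardy_eval h z = hardy_eval (hardy_eval w z) z"
        using wandering_analysis[OF N inv] by blast
      then have "mult_op \<Phi> w = h" by (intro mult_op_eqI) (simp add: \<Phi>_def)
      with w(1) show "h \<in> mult_op \<Phi> ` hardy_on (wandering N)" by blast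
    qed
  qed (use mult in blast)
qed

lemma brownian_shift_invariant_iff:
  "brownian_shift \<sigma> \<theta> ` (N \<times> {0}) \<subseteq> N \<times> {0} \<longleftrightarrow> hardy_shift ` N \<subseteq> N"
proof -
  have "hardy_const (0 :: 'a) = 0" by transfer auto
  then have "brownian_shift \<sigma> \<theta> (f, 0 :: 'a) = (hardy_shift f, 0)" for f
    by (simp add: brownian_shift_def)
  then have "brownian_shift \<sigma> \<theta> ` (N \<times> {0}) = (hardy_shift ` N) \<times> {0}"
    by (auto simp: image_iff)
  then show ?thesis by auto
qed

lemma brownian_shift_range_invariant:
  assumes "closed_csubspace F" "inner_function F \<Phi>" "M = (mult_op \<Phi> ` hardy_on F) \<times> {0}"
  shows "brownian_shift \<sigma> \<theta> ` M \<subseteq> M"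
  unfolding assms(3) brownian_shift_invariant_iff
  by (rule range_mult_op_shift_invariant[OF assms(1,2)])

theorem theorem2p1:
  fixes M :: "('e::chilbert_space hardy \<times> 'e) set" and \<sigma> \<theta> :: real
  assumes "separable_space (euclidean :: 'e topology)"
    and "\<sigma> > 0" and "0 \<le> \<theta>" and "\<theta> < 2 * pi"
    and "closed_csubspace M" and "M \<noteq> {0}"
    and "M \<subseteq> UNIV \<times> {0}"
  shows "(brownian_shift \<sigma> \<theta> ` M \<subseteq> M \<longleftrightarrow>
      (\<exists>(E1 :: 'e hardy set) \<Phi>. closed_csubspace E1 \<and> E1 \<noteq> {0} \<and> inner_function E1 \<Phi> \<and>
        M = (mult_op \<Phi> ` hardy_on E1) \<times> {0})) \<and>
    (\<forall>(E1 :: 'f::chilbert_space set) \<Phi>. closed_csubspace E1 \<and> E1 \<noteq> {0} \<and> inner_function E1 \<Phi> \<and>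
        M = (mult_op \<Phi> ` hardy_on E1) \<times> {0} \<longrightarrow> brownian_shift \<sigma> \<theta> ` M \<subseteq> M)"
proof -
  have representation: "\<exists>(E1 :: 'e hardy set) \<Phi>. closed_csubspace E1 \<and> E1 \<noteq> {0} \<and>
      inner_function E1 \<Phi> \<and> M = (mult_op \<Phi> ` hardy_on E1) \<times> {0}"
    if inv: "brownian_shift \<sigma> \<theta> ` M \<subseteq> M"
  proof -
    define N where "N = (\<lambda>f. (f, 0 :: 'e)) -` M"
    have M: "M = N \<times> {0}" using \<open>M \<subseteq> UNIV \<times> {0}\<close> by (auto simp: N_def)
    have "closed M" and sub: "complex_vector.subspace M"
      using \<open>closed_csubspace M\<close> by (simp_all add: closed_csubspace_def)
    have "continuous_on UNIV (\<lambda>f :: 'e hardy. (f, 0 :: 'e))" by (intro continuous_intros)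
    then have "closed N" unfolding N_def by (rule closed_vimage[OF \<open>closed M\<close>])
    moreover have "complex_vector.subspace N"
      unfolding complex_vector.subspace_def
    proof (intro conjI ballI allI)
      show "0 \<in> N" using complex_vector.subspace_0[OF sub] by (simp add: N_def zero_prod_def)
      show "f + g \<in> N" if "f \<in> N" "g \<in> N" for f g
        using complex_vector.subspace_add[OF sub, of "(f, 0)" "(g, 0)"] that by (simp add: N_def)
      show "c *\<^sub>C f \<in> N" if "f \<in> N" for c f
        using complex_vector.subspace_scale[OF sub, of "(f, 0)" c] that
        by (simp add: N_def scaleC_prod_def)
    qed
    ultimately have N: "closed_csubspace N" by (simp add: closed_csubspace_def)
    have S: "hardy_shift ` N \<subseteq> N" using inv unfolding M brownian_shift_invariant_iff .
    note BL = beurling_lax[OF N S]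
    have "wandering N \<noteq> {0}"
    proof
      assume "wandering N = {0}"
      then have "hardy_on (wandering N) = {0}" by (simp only: hardy_on_zero)
      then have "N = {mult_op (\<lambda>z x. hardy_eval x z) 0}" using BL(2) by (simp only: image_insert image_empty)
      moreover have "0 \<in> N" using N by (simp add: closed_csubspace_def complex_vector.subspace_0)
      ultimately have "N = {0}" by (metis singletonD)
      then have "M = {0}" by (simp add: M zero_prod_def)
      then show False using \<open>M \<noteq> {0}\<close> by contradiction
    qed
    then show ?thesis using closed_csubspace_wandering[OF N] BL M by blast
  qed
  show ?thesis
    by (intro conjI iffI allI impI; (elim exE conjE)?)
      (erule representation, (erule (2) brownian_shift_range_invariant)+)
qed

end
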